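(* Let $k\ge 1$ be a fixed integer. (1) $\mathrm{Cond}(V_{\Phi_n})$ is polynomially bounded in $n$ as $n$ ranges over the integers $n\ge 2$ having at most $k$ distinct prime divisors; that is, there are constants $C,c>0$ depending only on $k$ such that $\mathrm{Cond}(V_{\Phi_n})\le C n^{c}$ for all such $n$. (2) More generally, let $\mathcal{F}_k$ be a family of cyclotomic polynomials $\Phi_n$ ($n\ge 2$) such that each conductor $n$ is divisible by at most $k$ distinct primes, and let $r\ge 0$ be such that $A(n)=O(n^r)$ for $\Phi_n\in\mathcal{F}_k$. Then, for $\Phi_n\in\mathcal{F}_k$, $$\mathrm{Cond}(V_{\Phi_n})=O\left(n^{2^k+k+3+r}\right).$$
   Context: For $n\ge 2$, $\Phi_n$ is the $n$-th cyclotomic polynomial ($n$ is called its conductor), $m=\phi(n)$ its degree ($\phi$ is Euler's totient), and $\zeta_1,\dots,\zeta_m\in\mathbb{C}$ are the primitive $n$-th roots of unity (in any fixed order). $V_{\Phi_n}$ is the $m\times m$ Vandermonde matrix whose $(i,j)$ entry is $\zeta_i^{\,j-1}$, $1\le i,j\le m$. For a complex matrix $A=(a_{ij})$, $\|A\|=\sqrt{\sum_{i,j}|a_{ij}|^2}$ is the Frobenius norm, and for invertible $A$, $\mathrm{Cond}(A)=\|A\|\,\|A^{-1}\|$. $A(n)$ denotes the maximum of the absolute values of the coefficients of $\Phi_n$. The implied constants in the $O$-notation do not depend on $n$ (they may depend on $k$, $r$ and the family). *)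

theory Defs
  imports
    "HOL-Number_Theory.Totient"
    "HOL-Computational_Algebra.Polynomial"
    "Jordan_Normal_Form.Gauss_Jordan_Elimination"
    Complex_Main
begin

definition primitive_roots_of_unity :: "nat \<Rightarrow> complex set" where
  "primitive_roots_of_unity n = {z. z ^ n = 1 \<and> (\<forall>d. 0 < d \<and> d < n \<longrightarrow> z ^ d \<noteq> 1)}"

definition cyclotomic_poly :: "nat \<Rightarrow> complex poly" where
  "cyclotomic_poly n = (\<Prod>z\<in>primitive_roots_of_unity n. [:- z, 1:])"

definition cyclotomic_height :: "nat \<Rightarrow> real" where
  "cyclotomic_height n =
     Max ((\<lambda>i. norm (coeff (cyclotomic_poly n) i)) ` {..degree (cyclotomic_poly n)})"

text \<open>
  Matrix indices and enumerations start at 0, so the \<open>(i, j)\<close> entry below is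
  \<open>\<zeta>\<^sub>i\<close> to the power \<open>j\<close>, not \<open>j - 1\<close>.
\<close>

definition enumerates_primitive_roots :: "nat \<Rightarrow> (nat \<Rightarrow> complex) \<Rightarrow> bool" where
  "enumerates_primitive_roots n \<zeta> \<longleftrightarrow>
     bij_betw \<zeta> {..<totient n} (primitive_roots_of_unity n)"

definition vandermonde_mat :: "nat \<Rightarrow> (nat \<Rightarrow> complex) \<Rightarrow> complex mat" where
  "vandermonde_mat m \<zeta> = mat m m (\<lambda>(i, j). \<zeta> i ^ j)"

definition frobenius_norm :: "complex mat \<Rightarrow> real" where
  "frobenius_norm A = sqrt (\<Sum>i<dim_row A. \<Sum>j<dim_col A. (norm (A $$ (i, j)))\<^sup>2)"

text \<open>Only meaningful for invertible \<open>A\<close>; otherwise \<open>mat_inverse A\<close> is \<open>None\<close>.\<close>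

definition cond_number :: "complex mat \<Rightarrow> real" where
  "cond_number A = frobenius_norm A * frobenius_norm (the (mat_inverse A))"

text \<open>
  There are \<open>\<phi>(n)\<close> primitive \<open>n\<close>-th roots of unity, so enumerations by
  \<open>{..<totient n}\<close> exist.
\<close>

lemma root_of_unity_power_eq_1_iff:
  assumes "n > 0"
  shows "cis (2 * pi * real k / real n) ^ d = 1 \<longleftrightarrow> n dvd k * d"
proof -
  have inj: "inj_on (\<lambda>k. cis (2 * pi * real k / real n)) {..<n}"
    using bij_betw_roots_unity[OF assms] by (simp add: bij_betw_def)
  define q where "q = (k * d) div n"
  define r where "r = (k * d) mod n"
  have r: "r < n" using assms by (simp add: r_def)
  have kd: "k * d = q * n + r" by (simp add: q_def r_def)
  have "cis (2 * pi * real k / real n) ^ d = cis (2 * pi * real (k * d) / real n)"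
    by (simp add: Complex.DeMoivre mult_ac)
  also have "2 * pi * real (k * d) / real n = 2 * pi * real q + 2 * pi * real r / real n"
    unfolding kd using assms by (simp add: field_simps)
  also have "cis \<dots> = cis (2 * pi * real r / real n)"
    by (simp flip: cis_mult)
  finally have eq: "cis (2 * pi * real k / real n) ^ d = cis (2 * pi * real r / real n)" .
  have "cis (2 * pi * real r / real n) = 1 \<longleftrightarrow> r = 0"
    using inj_onD[OF inj, of r 0] r assms by auto
  with eq show ?thesis by (simp add: r_def dvd_eq_mod_eq_0)
qed

lemma primitive_roots_of_unity_eq:
  assumes "n \<ge> 2"
  shows "primitive_roots_of_unity n = (\<lambda>k. cis (2 * pi * real k / real n)) ` totatives n"
proof -
  have n: "n > 0" using assms by simp
  have all: "z ^ n = 1 \<longleftrightarrow> z \<in> (\<lambda>k. cis (2 * pi * real k / real n)) ` {..<n}" for z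
    using bij_betw_roots_unity[OF n] by (auto simp: bij_betw_def)
  have cop: "coprime k n \<longleftrightarrow> (\<forall>d. 0 < d \<and> d < n \<longrightarrow> \<not> n dvd k * d)" for k
  proof
    assume "coprime k n"
    thus "\<forall>d. 0 < d \<and> d < n \<longrightarrow> \<not> n dvd k * d"
      by (metis coprime_commute coprime_dvd_mult_right_iff nat_dvd_not_less)
  next
    assume *: "\<forall>d. 0 < d \<and> d < n \<longrightarrow> \<not> n dvd k * d"
    show "coprime k n"
    proof (rule ccontr)
      assume "\<not> coprime k n"
      define g where "g = gcd k n"
      have "g \<noteq> 1" using \<open>\<not> coprime k n\<close> by (auto simp: g_def coprime_iff_gcd_eq_1)
      moreover have "g > 0" using n by (simp add: g_def)
      ultimately have "g > 1" by simp
      obtain a b where k: "k = g * a" and nb: "n = g * b"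
        unfolding g_def by (meson dvd_def gcd_dvd1 gcd_dvd2)
      have "b > 0" using n nb by (cases b) auto
      have "b < n" using \<open>g > 1\<close> \<open>b > 0\<close> nb by simp
      have "n dvd k * b" unfolding k nb by (metis dvd_triv_left mult.assoc mult.commute)
      with * \<open>b > 0\<close> \<open>b < n\<close> show False by blast
    qed
  qed
  have "totatives n = {k \<in> {..<n}. coprime k n}"
    using assms totatives_less[of _ n]
    by (fastforce simp: totatives_def intro: Nat.gr0I)
  thus ?thesis
    unfolding primitive_roots_of_unity_def all
    by (auto simp: root_of_unity_power_eq_1_iff[OF n] cop)
qed

lemma card_primitive_roots_of_unity:
  assumes "n \<ge> 2"
  shows "card (primitive_roots_of_unity n) = totient n"
proof -
  have "totatives n \<subseteq> {..<n}"
    using assms totatives_less[of _ n] by auto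
  moreover have "inj_on (\<lambda>k. cis (2 * pi * real k / real n)) {..<n}"
    using bij_betw_roots_unity[of n] assms by (simp add: bij_betw_def)
  ultimately show ?thesis
    unfolding primitive_roots_of_unity_eq[OF assms] totient_def
    by (metis card_image inj_on_subset)
qed

lemma ex_enumerates_primitive_roots:
  assumes "n \<ge> 2"
  shows "\<exists>\<zeta>. enumerates_primitive_roots n \<zeta>"
  unfolding enumerates_primitive_roots_def
  by (rule finite_same_card_bij)
     (simp_all add: card_primitive_roots_of_unity[OF assms],
      simp add: primitive_roots_of_unity_eq[OF assms])

end

theory Submission
  imports
    Defs
    "HOL-Computational_Algebra.Polynomial_FPS"
    "Jordan_Normal_Form.Determinant"
begin

text \<open>
  For a set \<open>P\<close> of primes dividing \<open>d\<close>, let \<open>\<Psi>\<^bsub>d,P\<^esub>\<close> be the monic polynomial whose roots are the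
  \<open>d\<close>-th roots of unity \<open>z\<close> with \<open>z\<^bsup>d/p\<^esup> \<noteq> 1\<close> for all \<open>p \<in> P\<close>.  It interpolates between
  \<open>\<Psi>\<^bsub>n,{}\<^esub> = x\<^sup>n - 1\<close> and \<open>\<Psi>\<^bsub>n,P\<^esub> = \<Phi>\<^sub>n\<close> (\<open>P\<close> the set of all prime divisors of \<open>n\<close>), and
  \<open>\<Psi>\<^bsub>d,P\<^esub> = \<Psi>\<^bsub>d,P\<union>{p}\<^esub> \<Psi>\<^bsub>d/p,P\<^esub>\<close>.  Along this recursion, bounds for the coefficients of the
  power series \<open>\<Psi>\<close> and \<open>1/\<Psi>\<close>, and for \<open>\<bar>\<Psi>\<^bsub>d,P\<^esub>(\<zeta>)\<bar>\<close> and its inverse at a primitive \<open>n\<close>-th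
  root of unity \<open>\<zeta>\<close>, are squared at each step.  Hence \<open>A(n) \<le> n\<^bsup>2^k\<^esup>\<close> and
  \<open>\<bar>\<Phi>\<^sub>n'(\<zeta>)\<bar> \<ge> n\<^bsup>-2^k\<^esup>\<close>.  The inverse of the Vandermonde matrix consists of the coefficients of
  the Lagrange polynomials \<open>\<Phi>\<^sub>n / ((x - \<zeta>\<^sub>i) \<Phi>\<^sub>n'(\<zeta>\<^sub>i))\<close>, which Horner's scheme bounds by
  \<open>\<phi>(n) A(n) / \<bar>\<Phi>\<^sub>n'(\<zeta>\<^sub>i)\<bar>\<close>.
\<close>

section \<open>Roots of unity avoiding given subgroups\<close>

definition sieved_roots :: "nat \<Rightarrow> nat set \<Rightarrow> complex set" where
  "sieved_roots d P = {z. z ^ d = 1 \<and> (\<forall>p\<in>P. z ^ (d div p) \<noteq> 1)}"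

definition sieved_poly :: "nat \<Rightarrow> nat set \<Rightarrow> complex poly" where
  "sieved_poly d P = (\<Prod>z\<in>sieved_roots d P. [:- z, 1:])"

text \<open>Makes \<open>d div p\<close> exact for each \<open>p\<close> in \<open>P\<close>;
  \<open>d\<close> may have further or repeated prime factors.\<close>

definition prime_divisor_set :: "nat \<Rightarrow> nat set \<Rightarrow> bool" where
  "prime_divisor_set d P \<longleftrightarrow> finite P \<and> d > 0 \<and> (\<forall>p\<in>P. prime p \<and> p dvd d)"

lemma finite_sieved_roots: "d > 0 \<Longrightarrow> finite (sieved_roots d P)"
  by (rule finite_subset[OF _ finite_roots_unity[of d, where ?'a = complex]])
     (auto simp: sieved_roots_def)

text \<open>Bezout in subtraction-free form, so that no inverse of \<open>z\<close> is
  required.\<close>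

lemma power_gcd_eq_1:
  fixes z :: "'a :: monoid_mult"
  assumes "z ^ a = 1" "z ^ b = 1"
  shows "z ^ gcd a b = 1"
proof (cases "a = 0")
  case False
  then obtain x y where "a * x = b * y + gcd a b" using bezout_nat by blast
  hence "z ^ (a * x) = z ^ (b * y) * z ^ gcd a b" by (simp add: power_add)
  thus ?thesis using assms by (simp add: power_mult)
qed (use assms in auto)

text \<open>An exponent \<open>d < n\<close> with \<open>z ^ d = 1\<close> can be replaced by
  \<open>gcd d n\<close>, a proper divisor of \<open>n\<close>, which divides \<open>n div p\<close>
  for some prime \<open>p\<close>. Testing the exponents \<open>n div p\<close> therefore
  suffices.\<close>

lemma sieved_roots_primes:
  assumes "n > 0"
  shows "sieved_roots n (prime_factors n) = primitive_roots_of_unity n"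
proof (intro equalityI subsetI)
  fix z assume z: "z \<in> sieved_roots n (prime_factors n)"
  have "z ^ d \<noteq> 1" if d: "0 < d" "d < n" for d
  proof
    assume "z ^ d = 1"
    define g where "g = gcd d n"
    have g: "z ^ g = 1"
      using z power_gcd_eq_1[OF \<open>z ^ d = 1\<close>] by (simp add: g_def sieved_roots_def)
    have "g dvd n" "g < n" using d by (auto simp: g_def intro: le_less_trans[OF gcd_le1_nat])
    then obtain q where q: "n = g * q" by blast
    with \<open>g < n\<close> have "q \<noteq> 1" by auto
    then obtain p where p: "prime p" "p dvd q" using prime_factor_nat by blast
    then obtain r where r: "q = p * r" by blast
    have "n div p = g * r" using q r p(1) prime_gt_0_nat[OF p(1)] by simp
    hence "z ^ (n div p) = 1" using g by (simp add: power_mult)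
    moreover have "p \<in> prime_factors n" using p q assms by (simp add: prime_factors_dvd)
    ultimately show False using z by (auto simp: sieved_roots_def)
  qed
  thus "z \<in> primitive_roots_of_unity n"
    using z by (auto simp: sieved_roots_def primitive_roots_of_unity_def)
next
  fix z assume z: "z \<in> primitive_roots_of_unity n"
  have "z ^ (n div p) \<noteq> 1" if "p \<in> prime_factors n" for p
  proof -
    have p: "prime p" "p dvd n" using that by (auto simp: prime_factors_dvd)
    hence "0 < n div p" "n div p < n"
      using assms prime_gt_1_nat[OF p(1)] by (auto elim!: dvdE)
    thus ?thesis using z by (auto simp: primitive_roots_of_unity_def)
  qed
  thus "z \<in> sieved_roots n (prime_factors n)"
    using z by (auto simp: sieved_roots_def primitive_roots_of_unity_def)
qed

lemma prime_divisor_set_insertD: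
  assumes "prime_divisor_set d (insert p P)" "p \<notin> P"
  shows "prime_divisor_set d P" "prime_divisor_set (d div p) P" "prime p" "p dvd d"
proof -
  show p: "prime p" "p dvd d" using assms by (auto simp: prime_divisor_set_def)
  have d: "d > 0" "d div p > 0" using assms p prime_gt_0_nat[OF p(1)]
    by (auto simp: prime_divisor_set_def elim!: dvdE)
  have "q dvd d div p" if q: "q \<in> P" for q
  proof -
    have "prime q" "q dvd d" "q \<noteq> p" using assms q by (auto simp: prime_divisor_set_def)
    moreover have "d = p * (d div p)" using p by simp
    ultimately show ?thesis using p
      by (metis prime_dvd_mult_iff primes_dvd_imp_eq)
  qed
  thus "prime_divisor_set d P" "prime_divisor_set (d div p) P"
    using assms d by (auto simp: prime_divisor_set_def)
qed

text \<open>Split the roots by whether \<open>z ^ (d div p) = 1\<close>. Where this holds, the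
  conditions for \<open>q\<close> in \<open>P\<close> change exponent from \<open>d div q\<close> to
  \<open>d div p div q\<close>, which \<open>key\<close> justifies.\<close>

lemma sieved_roots_insert:
  assumes "prime_divisor_set d (insert p P)" "p \<notin> P"
  shows "sieved_roots d P = sieved_roots d (insert p P) \<union> sieved_roots (d div p) P"
    and "sieved_roots d (insert p P) \<inter> sieved_roots (d div p) P = {}"
proof -
  note D = prime_divisor_set_insertD[OF assms]
  have d: "d = (d div p) * p" using D by simp
  have pow_d: "z ^ d = 1" if "z ^ (d div p) = 1" for z :: complex
    using that d by (metis power_mult power_one)
  \<comment> \<open>With \<open>e = d / (p q)\<close>, the assumption says
    \<open>(z ^ e) ^ q = 1\<close>; if also \<open>(z ^ e) ^ p = 1\<close>, coprimality of
    \<open>p\<close> and \<open>q\<close> forces \<open>z ^ e = 1\<close>.\<close>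
  have key: "z ^ (d div p div q) = 1 \<longleftrightarrow> z ^ (d div q) = 1"
    if q: "q \<in> P" and z: "z ^ (d div p) = 1" for q and z :: complex
  proof -
    define e where "e = d div p div q"
    have pq: "prime q" "q dvd d div p" "q \<noteq> p"
      using D(2) q assms(2) by (auto simp: prime_divisor_set_def)
    have dp: "d div p = e * q" using pq by (simp add: e_def)
    have dq: "d div q = e * p"
      using d dp prime_gt_0_nat[OF pq(1)] by (metis mult.assoc mult.commute 
        nonzero_mult_div_cancel_left less_numeral_extra(3))
    show ?thesis
    proof
      assume "z ^ (d div p div q) = 1"
      thus "z ^ (d div q) = 1" by (simp add: dq power_mult flip: e_def)
    next
      assume "z ^ (d div q) = 1"
      hence "(z ^ e) ^ p = 1" "(z ^ e) ^ q = 1" using z by (simp_all add: dq dp power_mult)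
      hence "(z ^ e) ^ gcd p q = 1" by (rule power_gcd_eq_1)
      moreover have "gcd p q = 1"
        using pq D(3) by (simp add: primes_coprime coprime_imp_gcd_eq_1)
      ultimately show "z ^ (d div p div q) = 1" by (simp add: e_def)
    qed
  qed
  show "sieved_roots d P = sieved_roots d (insert p P) \<union> sieved_roots (d div p) P"
    using key pow_d by (auto simp: sieved_roots_def)
  show "sieved_roots d (insert p P) \<inter> sieved_roots (d div p) P = {}"
    by (auto simp: sieved_roots_def)
qed

lemma sieved_poly_insert:
  assumes "prime_divisor_set d (insert p P)" "p \<notin> P"
  shows "sieved_poly d P = sieved_poly d (insert p P) * sieved_poly (d div p) P"
proof -
  have "d > 0" "d div p > 0"
    using prime_divisor_set_insertD[OF assms] by (auto simp: prime_divisor_set_def)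
  thus ?thesis
    unfolding sieved_poly_def sieved_roots_insert(1)[OF assms]
    by (intro prod.union_disjoint finite_sieved_roots sieved_roots_insert(2)[OF assms])
qed

lemma degree_prod_linear: "degree (\<Prod>z\<in>A. [:- z, 1 :: complex:]) = card A"
  by (subst degree_prod_sum_eq) auto

text \<open>Both sides are monic of degree \<open>d\<close> and agree at the \<open>d\<close>
  distinct roots of unity.\<close>

lemma sieved_poly_empty:
  assumes "d > 0"
  shows "sieved_poly d {} = monom 1 d - 1"
proof (rule poly_eqI_degree_lead_coeff)
  let ?A = "{z :: complex. z ^ d = 1}"
  have R: "sieved_roots d {} = ?A" by (simp add: sieved_roots_def)
  have card: "card ?A = d" using assms by (rule card_roots_unity_eq)
  have deg: "degree (sieved_poly d {}) = d"
    using card by (simp only: sieved_poly_def degree_prod_linear R)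
  have "lead_coeff (sieved_poly d {}) = 1"
    by (simp add: sieved_poly_def lead_coeff_prod)
  thus "coeff (sieved_poly d {}) d = coeff (monom 1 d - 1) d"
    using assms deg by simp
  show "d \<le> card ?A" "degree (sieved_poly d {}) \<le> d" using card deg by simp_all
  show "degree (monom 1 d - 1 :: complex poly) \<le> d"
    by (intro degree_diff_le degree_monom_le) simp
  fix z assume "z \<in> ?A"
  thus "poly (sieved_poly d {}) z = poly (monom 1 d - 1) z"
    using finite_sieved_roots[OF assms, of "{}"]
    by (auto simp: sieved_poly_def poly_prod R poly_monom)
qed

lemma sieved_poly_primes:
  assumes "n > 0"
  shows "sieved_poly n (prime_factors n) = cyclotomic_poly n"
  using assms by (simp add: sieved_poly_def cyclotomic_poly_def sieved_roots_primes)

section \<open>The height of cyclotomic polynomials\<close>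

text \<open>The cutoff \<open>N\<close> is there because inverses are infinite series: up to index
  \<open>N\<close>, a coefficient of a Cauchy product has at most \<open>N + 1\<close>
  summands.\<close>

definition coeffs_bounded :: "nat \<Rightarrow> real \<Rightarrow> complex fps \<Rightarrow> bool" where
  "coeffs_bounded N B f \<longleftrightarrow> (\<forall>i\<le>N. norm (fps_nth f i) \<le> B)"

lemma coeffs_bounded_mult:
  assumes "coeffs_bounded N B f" "coeffs_bounded N C g"
  shows "coeffs_bounded N ((real N + 1) * B * C) (f * g)"
  unfolding coeffs_bounded_def
proof (intro allI impI)
  fix n assume n: "n \<le> N"
  have "norm (fps_nth f 0) \<le> B" "norm (fps_nth g 0) \<le> C"
    using assms by (auto simp: coeffs_bounded_def)
  hence B: "0 \<le> B" and C: "0 \<le> C" using norm_ge_zero order_trans by blast+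
  have "norm (fps_nth (f * g) n) \<le> (\<Sum>i=0..n. norm (fps_nth f i * fps_nth g (n - i)))"
    unfolding fps_mult_nth by (rule norm_sum)
  also have "\<dots> \<le> (\<Sum>i=0..n. B * C)"
    using assms n B by (intro sum_mono) (auto simp: coeffs_bounded_def norm_mult intro!: mult_mono)
  also have "\<dots> = (real n + 1) * (B * C)" by simp
  also have "\<dots> \<le> (real N + 1) * (B * C)" using n B C by (intro mult_right_mono) auto
  finally show "norm (fps_nth (f * g) n) \<le> (real N + 1) * B * C" by (simp add: mult_ac)
qed

text \<open>The geometric series for \<open>- 1 / (1 - x ^ d)\<close>.\<close>

lemma inverse_fps_X_power_minus_1:
  assumes "d > 0"
  shows "inverse (fps_X ^ d - 1 :: 'a :: field fps) = Abs_fps (\<lambda>i. if d dvd i then - 1 else 0)"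
proof (rule fps_inverse_unique)
  show "(fps_X ^ d - 1 :: 'a fps) * Abs_fps (\<lambda>i. if d dvd i then - 1 else 0) = 1"
  proof (rule fps_ext)
    fix i
    have "d dvd i - d \<longleftrightarrow> d dvd i" if "i \<ge> d" using that by (simp add: dvd_minus_self)
    moreover have "i = 0" if "d dvd i" "i < d" using that by (auto dest: dvd_imp_le)
    ultimately show "fps_nth ((fps_X ^ d - 1 :: 'a fps) * Abs_fps (\<lambda>i. if d dvd i then - 1 else 0)) i
        = fps_nth 1 i"
      using assms by (auto simp: algebra_simps fps_X_power_mult_nth)
  qed
qed

text \<open>Series and inverse are bounded together because each step forms a quotient of two
  earlier series. \<open>N\<close> stays fixed while \<open>d\<close> shrinks.\<close>

lemma coeffs_bounded_sieved_poly:
  assumes "finite P" "prime_divisor_set d P"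
  shows "coeffs_bounded N ((real N + 1) ^ (2 ^ card P - 1)) (fps_of_poly (sieved_poly d P))
    \<and> coeffs_bounded N ((real N + 1) ^ (2 ^ card P - 1)) (inverse (fps_of_poly (sieved_poly d P)))"
  using assms
proof (induction P arbitrary: d rule: finite_induct)
  case empty
  hence d: "d > 0" by (simp add: prime_divisor_set_def)
  have eq: "fps_of_poly (sieved_poly d {}) = fps_X ^ d - 1"
    using sieved_poly_empty[OF d] by (simp add: fps_of_poly_diff fps_of_poly_monom)
  show ?case
    using d unfolding eq inverse_fps_X_power_minus_1[OF d]
    by (auto simp: coeffs_bounded_def fps_one_nth)
next
  case (insert p P)
  define B where "B = (real N + 1) ^ (2 ^ card P - 1)"
  define f where "f d P = fps_of_poly (sieved_poly d P)" for d P
  \<comment> \<open>Multiplying two series bounded by \<open>B\<close> costs a factor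
    \<open>N + 1\<close>, so the exponent starts at 0 and obeys \<open>e' = 2 e + 1\<close>.\<close>
  have exp: "(2 :: nat) ^ card (insert p P) - 1 = Suc ((2 ^ card P - 1) + (2 ^ card P - 1))"
    using insert.hyps by (cases "(2 :: nat) ^ card P") simp_all
  have B: "(real N + 1) ^ (2 ^ card (insert p P) - 1) = (real N + 1) * B * B"
    unfolding exp B_def power_Suc power_add by (simp only: mult.assoc)
  note pd = insert.prems
  note D = prime_divisor_set_insertD[OF pd insert.hyps(2)]
  have f: "f d P = f d (insert p P) * f (d div p) P"
    by (simp add: f_def sieved_poly_insert[OF pd insert.hyps(2)] fps_of_poly_mult)
  \<comment> \<open>0 is not a root of unity, so the constant term is nonzero and the series is
    invertible.\<close>
  have nz: "fps_nth (f e Q) 0 \<noteq> 0" if "e > 0" for e Q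
    using that finite_sieved_roots[OF that, of Q]
    by (auto simp: f_def sieved_poly_def poly_prod sieved_roots_def power_0_left simp flip: poly_0_coeff_0)
  have e: "d > 0" "d div p > 0" using D by (auto simp: prime_divisor_set_def)
  have inv: "f (d div p) P * inverse (f (d div p) P) = 1"
    using e by (intro inverse_mult_eq_1' nz)
  have "f d (insert p P) = f d P * inverse (f (d div p) P)"
    using inv unfolding f by (simp add: mult.assoc)
  moreover have "inverse (f d (insert p P)) = inverse (f d P) * f (d div p) P"
    using inv unfolding f fps_inverse_mult by (simp add: mult_ac)
  moreover have "coeffs_bounded N B (f e P)" "coeffs_bounded N B (inverse (f e P))"
    if "prime_divisor_set e P" for e
    using insert.IH[OF that] by (simp_all add: f_def B_def)
  ultimately show ?case
    using D(1,2) unfolding B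
    by (simp add: coeffs_bounded_mult flip: f_def)
qed

lemma prime_divisor_set_prime_factors: "n > 0 \<Longrightarrow> prime_divisor_set n (prime_factors n)"
  by (auto simp: prime_divisor_set_def)

lemma degree_cyclotomic_poly: "n \<ge> 2 \<Longrightarrow> degree (cyclotomic_poly n) = totient n"
  by (simp add: cyclotomic_poly_def degree_prod_linear card_primitive_roots_of_unity)

lemma cyclotomic_height_le:
  assumes "n \<ge> 2"
  shows "cyclotomic_height n \<le> real n ^ (2 ^ card (prime_factors n))"
  unfolding cyclotomic_height_def
proof (subst Max_le_iff; safe?)
  fix i assume "i \<le> degree (cyclotomic_poly n)"
  hence i: "i \<le> n - 1"
    using totient_less[of n] assms by (simp add: degree_cyclotomic_poly)
  \<comment> \<open>The cutoff \<open>N = n - 1\<close> covers the degree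
    \<open>totient n < n\<close> and turns the base \<open>N + 1\<close> into
    \<open>n\<close>.\<close>
  have "norm (coeff (cyclotomic_poly n) i) \<le> (real (n - 1) + 1) ^ (2 ^ card (prime_factors n) - 1)"
    using coeffs_bounded_sieved_poly[OF _ prime_divisor_set_prime_factors, of n "n - 1"] i assms
    by (simp add: coeffs_bounded_def sieved_poly_primes)
  also have "real (n - 1) + 1 = real n" using assms by simp
  also have "real n ^ (2 ^ card (prime_factors n) - 1) \<le> real n ^ (2 ^ card (prime_factors n))"
    using assms by (intro power_increasing) auto
  finally show "norm (coeff (cyclotomic_poly n) i) \<le> real n ^ (2 ^ card (prime_factors n))" .
qed auto

lemma norm_coeff_le_cyclotomic_height: "norm (coeff (cyclotomic_poly n) i) \<le> cyclotomic_height n"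
proof (cases "i \<le> degree (cyclotomic_poly n)")
  case True
  thus ?thesis unfolding cyclotomic_height_def by (intro Max_ge) auto
next
  case False
  have "0 \<le> norm (coeff (cyclotomic_poly n) 0)" by simp
  also have "\<dots> \<le> cyclotomic_height n"
    unfolding cyclotomic_height_def by (intro Max_ge) auto
  finally show ?thesis using False by (simp add: coeff_eq_0)
qed

lemma cyclotomic_height_nonneg: "cyclotomic_height n \<ge> 0"
  using norm_coeff_le_cyclotomic_height[of n 0] norm_ge_zero order.trans by blast

section \<open>The derivative at a primitive root of unity\<close>

lemma norm_root_of_unity:
  fixes w :: complex
  assumes "w ^ n = 1" "n > 0"
  shows "norm w = 1"
proof -
  have "norm w ^ n = 1" using assms(1) by (simp flip: norm_power)
  thus ?thesis using assms(2) using power_eq_imp_eq_base[of "norm w" n 1] by simp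
qed

text \<open>The sum of all powers of \<open>w\<close> vanishes, so \<open>n = \<Sum>\<^bsub>i<n\<^esub> (1 - w\<^sup>i)\<close>, and each term is at most
  \<open>n \<bar>1 - w\<bar>\<close> in modulus.\<close>

lemma norm_root_of_unity_minus_1_ge:
  fixes w :: complex
  assumes "w ^ n = 1" "w \<noteq> 1" "n > 0"
  shows "norm (w - 1) \<ge> 1 / real n"
proof -
  have norm_w: "norm w = 1" using assms(1,3) by (rule norm_root_of_unity)
  have le: "norm (1 - w ^ i) \<le> real i * norm (w - 1)" for i
    using norm_power_diff[of 1 w i] norm_w by (simp add: norm_minus_commute)
  have "(\<Sum>i<n. 1 - w ^ i) = of_nat n"
    using assms by (simp add: sum_subtractf geometric_sum)
  hence "real n = norm (\<Sum>i<n. 1 - w ^ i)" by simp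
  also have "\<dots> \<le> (\<Sum>i<n. real n * norm (w - 1))"
    by (intro order.trans[OF norm_sum] sum_mono order.trans[OF le] mult_right_mono) auto
  finally have "real n * 1 \<le> real n * (real n * norm (w - 1))" by simp
  hence "1 \<le> real n * norm (w - 1)" using assms(3) by (subst (asm) mult_le_cancel_left_pos) auto
  thus ?thesis using assms(3) by (simp add: field_simps)
qed

text \<open>\<open>d < n\<close> keeps the base case \<open>\<zeta> ^ d - 1\<close> away from 0.
  Bounds in terms of \<open>n\<close> instead of \<open>d\<close> serve \<open>d\<close> and
  \<open>d div p\<close> alike.\<close>

lemma norm_sieved_poly_at_primitive_root:
  assumes "\<zeta> \<in> primitive_roots_of_unity n" "n \<ge> 2"
    and "finite P" "prime_divisor_set d P" "d < n"
  shows "norm (poly (sieved_poly d P) \<zeta>) \<le> real n ^ (2 ^ card P)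
    \<and> 1 / real n ^ (2 ^ card P) \<le> norm (poly (sieved_poly d P) \<zeta>)"
  using assms(3-5)
proof (induction P arbitrary: d rule: finite_induct)
  case empty
  hence d: "d > 0" by (simp add: prime_divisor_set_def)
  have eq: "poly (sieved_poly d {}) \<zeta> = \<zeta> ^ d - 1"
    by (simp add: sieved_poly_empty[OF d] poly_monom)
  have zn: "\<zeta> ^ n = 1" using assms(1) by (simp add: primitive_roots_of_unity_def)
  have "(\<zeta> ^ d) ^ n = 1" using zn by (metis power_commutes power_mult mult.commute power_one)
  moreover have "\<zeta> ^ d \<noteq> 1" using assms(1) d empty by (auto simp: primitive_roots_of_unity_def)
  ultimately have lower: "norm (\<zeta> ^ d - 1) \<ge> 1 / real n"
    using assms(2) by (intro norm_root_of_unity_minus_1_ge) auto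
  have "norm \<zeta> = 1" using norm_root_of_unity[OF zn] assms(2) by simp
  hence "norm (\<zeta> ^ d - 1) \<le> 2"
    using norm_triangle_ineq4[of "\<zeta> ^ d" 1] by (simp add: norm_power)
  with lower show ?case using assms(2) by (simp add: eq)
next
  case (insert p P)
  note D = prime_divisor_set_insertD[OF insert.prems(1) insert.hyps(2)]
  define B where "B = real n ^ (2 ^ card P)"
  have B: "B > 0" using assms(2) by (simp add: B_def)
  have BB: "real n ^ (2 ^ card (insert p P)) = B * B"
    using insert.hyps by (simp add: B_def mult_2 flip: power_add)
  have "d div p < n" using insert.prems(2) div_le_dividend[of d p] by linarith
  note IH = insert.IH[OF D(1) insert.prems(2)] insert.IH[OF D(2) this]
  define x where "x = norm (poly (sieved_poly d (insert p P)) \<zeta>)"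
  define y where "y = norm (poly (sieved_poly (d div p) P) \<zeta>)"
  have xy: "norm (poly (sieved_poly d P) \<zeta>) = x * y"
    by (simp add: x_def y_def sieved_poly_insert[OF insert.prems(1) insert.hyps(2)] norm_mult)
  have b: "x * y \<le> B" "1 / B \<le> x * y" "y \<le> B" "1 / B \<le> y"
    using IH by (simp_all add: xy flip: B_def y_def)
  have x: "x \<ge> 0" by (simp add: x_def)
  \<comment> \<open>Dividing \<open>x * y\<close> by \<open>y\<close> turns the two-sided bound
    \<open>B\<close> into \<open>B * B\<close>.\<close>
  have "x * (1 / B) \<le> B" using mult_left_mono[OF b(4) x] b(1) by linarith
  moreover have "1 / B \<le> x * B" using mult_left_mono[OF b(3) x] b(2) by linarith
  ultimately show ?case using B unfolding BB by (simp add: field_simps flip: x_def)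
qed

text \<open>The induction starts from \<open>n * \<zeta> ^ (n - 1)\<close>, of modulus
  \<open>n\<close>. Since \<zeta> is a root of the new factor, the product rule leaves one term, and
  each step loses only a value of modulus at most \<open>B\<close>.\<close>

lemma norm_pderiv_sieved_poly_ge:
  assumes "\<zeta> \<in> primitive_roots_of_unity n" "n \<ge> 2"
    and "finite P" "prime_divisor_set n P"
  shows "norm (poly (pderiv (sieved_poly n P)) \<zeta>) * real n ^ (2 ^ card P) \<ge> 1"
  using assms(3,4)
proof (induction P rule: finite_induct)
  case empty
  have "norm \<zeta> = 1"
    using assms(1,2) norm_root_of_unity[of \<zeta> n] by (simp add: primitive_roots_of_unity_def)
  moreover have "1 \<le> real n * real n" using assms(2) by (simp add: mult_ge1_I)
  ultimately show ?case using assms(2)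
    by (simp add: sieved_poly_empty pderiv_diff pderiv_monom poly_monom norm_mult norm_power)
next
  case (insert p P)
  note D = prime_divisor_set_insertD[OF insert.prems insert.hyps(2)]
  define B where "B = real n ^ (2 ^ card P)"
  have B: "B > 0" using assms(2) by (simp add: B_def)
  have BB: "real n ^ (2 ^ card (insert p P)) = B * B"
    using insert.hyps by (simp add: B_def mult_2 flip: power_add)
  have lt: "n div p < n" using assms(2) prime_gt_1_nat[OF D(3)] by simp
  have "\<zeta> \<in> sieved_roots n (insert p P)"
    using assms(1,2) insert.prems
    by (auto simp: prime_divisor_set_def prime_factors_dvd sieved_roots_def
             simp flip: sieved_roots_primes)
  hence "poly (sieved_poly n (insert p P)) \<zeta> = 0"
    using assms(2) finite_sieved_roots[of n "insert p P"]
    by (auto simp: sieved_poly_def poly_prod)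
  hence eq: "poly (pderiv (sieved_poly n P)) \<zeta> =
      poly (pderiv (sieved_poly n (insert p P))) \<zeta> * poly (sieved_poly (n div p) P) \<zeta>"
    by (simp add: sieved_poly_insert[OF insert.prems insert.hyps(2)] pderiv_mult)
  let ?x = "norm (poly (pderiv (sieved_poly n (insert p P))) \<zeta>)"
  have "1 \<le> ?x * norm (poly (sieved_poly (n div p) P) \<zeta>) * B"
    using insert.IH[OF D(1)] by (simp add: eq norm_mult B_def)
  also have "\<dots> \<le> ?x * B * B"
    using norm_sieved_poly_at_primitive_root[OF assms(1,2) insert.hyps(1) D(2) lt] B
    by (intro mult_right_mono mult_left_mono) (auto simp: B_def)
  finally show ?case unfolding BB by (simp add: mult_ac)
qed

lemma norm_pderiv_cyclotomic_poly_ge: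
  assumes "\<zeta> \<in> primitive_roots_of_unity n" "n \<ge> 2"
  shows "norm (poly (pderiv (cyclotomic_poly n)) \<zeta>) * real n ^ (2 ^ card (prime_factors n)) \<ge> 1"
  using norm_pderiv_sieved_poly_ge[OF assms _ prime_divisor_set_prime_factors] assms(2)
  by (simp add: sieved_poly_primes)

section \<open>The inverse of the Vandermonde matrix\<close>

text \<open>Horner's recursion \<open>q_j = a_(j+1) + z q_(j+1)\<close>, with \<open>a\<close> the
  coefficients of the product, runs down from \<open>q_m = 0\<close>; as \<open>z\<close> has
  modulus at most 1, each step adds at most \<open>H\<close>.\<close>

lemma norm_coeff_quotient_linear_le:
  fixes z :: complex
  assumes "norm z \<le> 1" and H: "\<And>i. norm (coeff ([:- z, 1:] * q) i) \<le> H" and "degree q < m"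
  shows "norm (coeff q j) \<le> real m * H"
proof -
  have H0: "H \<ge> 0" using H[of 0] norm_ge_zero order_trans by blast
  have step: "norm (coeff q j) \<le> H + norm (coeff q (Suc j))" for j
  proof -
    have "coeff q j = coeff ([:- z, 1:] * q) (Suc j) + z * coeff q (Suc j)" by simp
    also have "norm \<dots> \<le> H + norm z * norm (coeff q (Suc j))"
      by (intro order.trans[OF norm_triangle_ineq] add_mono H) (simp add: norm_mult)
    also have "norm z * norm (coeff q (Suc j)) \<le> 1 * norm (coeff q (Suc j))"
      using assms(1) by (intro mult_right_mono) auto
    finally show ?thesis by simp
  qed
  have bound: "norm (coeff q (m - l)) \<le> real l * H" if "l \<le> m" for l
    using that
  proof (induction l)
    case 0
    show ?case using assms(3) by (simp add: coeff_eq_0)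
  next
    case (Suc l)
    hence "Suc (m - Suc l) = m - l" by simp
    thus ?case using step[of "m - Suc l"] Suc by (simp add: algebra_simps)
  qed
  show ?thesis
  proof (cases "j \<le> m")
    case True
    hence "norm (coeff q j) \<le> real (m - j) * H"
      using bound[of "m - j"] by simp
    also have "\<dots> \<le> real m * H" using H0 by (intro mult_right_mono) auto
    finally show ?thesis .
  next
    case False
    thus ?thesis using assms(3) H0 by (simp add: coeff_eq_0)
  qed
qed

text \<open>A right inverse of a square matrix over a field is two-sided, so
  \<open>mat_inverse\<close> succeeds, and inverses are unique.\<close>

lemma mat_inverse_eqI:
  fixes A B :: "'a :: field mat"
  assumes A: "A \<in> carrier_mat n n" and B: "B \<in> carrier_mat n n" and AB: "A * B = 1\<^sub>m n"
  shows "mat_inverse A = Some B"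
proof -
  have BA: "B * A = 1\<^sub>m n" by (rule mat_mult_left_right_inverse[OF A B AB])
  hence "A \<in> Units (ring_mat TYPE('a) n undefined)"
    using A B AB by (auto simp: Units_def ring_mat_simps)
  then obtain C where C: "mat_inverse A = Some C"
    using mat_inverse(1)[OF A, where b = undefined] by (cases "mat_inverse A") auto
  with mat_inverse(2)[OF A C] have "C * A = 1\<^sub>m n" "C \<in> carrier_mat n n" by auto
  hence "(C * A) * B = C" using A B AB by (subst assoc_mult_mat[of _ n n _ n _ n]) auto
  thus ?thesis using \<open>C * A = 1\<^sub>m n\<close> B C by simp
qed

lemma frobenius_norm_le:
  assumes "A \<in> carrier_mat m m" "B \<ge> 0" "\<And>i j. i < m \<Longrightarrow> j < m \<Longrightarrow> norm (A $$ (i, j)) \<le> B"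
  shows "frobenius_norm A \<le> real m * B"
proof -
  have "(\<Sum>i<dim_row A. \<Sum>j<dim_col A. (norm (A $$ (i, j)))\<^sup>2) \<le> (\<Sum>i<m. \<Sum>j<m. B\<^sup>2)"
    using assms by (simp only: carrier_matD) (intro sum_mono power_mono, auto)
  also have "\<dots> = (real m * B)\<^sup>2" by (simp add: power2_eq_square)
  finally show ?thesis
    unfolding frobenius_norm_def using assms(2) by (intro real_le_lsqrt) auto
qed

lemma frobenius_norm_nonneg: "frobenius_norm A \<ge> 0"
  unfolding frobenius_norm_def by (intro real_sqrt_ge_zero sum_nonneg) auto

text \<open>The cube collects one factor \<open>m \<le> n\<close> each from the norm of
  \<open>V\<close>, the norm of \<open>W\<close> and Horner's bound.\<close>

lemma cond_number_le:
  assumes n: "n \<ge> 2" and enum: "enumerates_primitive_roots n \<zeta>"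
  shows "cond_number (vandermonde_mat (totient n) \<zeta>)
    \<le> real n ^ 3 * cyclotomic_height n * real n ^ (2 ^ card (prime_factors n))"
proof -
  define m where "m = totient n"
  define S where "S = primitive_roots_of_unity n"
  define V where "V = vandermonde_mat m \<zeta>"
  define B where "B = real n ^ (2 ^ card (prime_factors n))"
  define H where "H = cyclotomic_height n"
  define L where "L i = (\<Prod>z\<in>S - {\<zeta> i}. [:- z, 1:])" for i
  \<comment> \<open>Column \<open>i\<close> holds the coefficients of a Lagrange basis polynomial,
    so entry \<open>(l, i)\<close> of \<open>V * W\<close> is its value at
    \<open>\<zeta> l\<close>.\<close>
  define W where "W = mat m m (\<lambda>(j, i). coeff (L i) j / poly (L i) (\<zeta> i))"
  have bij: "bij_betw \<zeta> {..<m} S"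
    using enum by (simp add: enumerates_primitive_roots_def m_def S_def)
  have fin: "finite S" using bij bij_betw_finite by blast
  have \<zeta>S: "\<zeta> i \<in> S" if "i < m" for i using bij that by (auto simp: bij_betw_def)
  have \<zeta>1: "norm (\<zeta> i) = 1" if "i < m" for i
    using \<zeta>S[OF that] n norm_root_of_unity[of "\<zeta> i" n]
    by (simp add: S_def primitive_roots_of_unity_def)
  have H0: "H \<ge> 0" by (simp add: H_def cyclotomic_height_nonneg)
  have B0: "B > 0" using n by (simp add: B_def)
  have mn: "real m \<le> real n" by (simp add: m_def totient_le)
  have \<Phi>: "cyclotomic_poly n = [:- \<zeta> i, 1:] * L i" if "i < m" for i
    unfolding cyclotomic_poly_def L_def using fin \<zeta>S[OF that]
    by (simp add: prod.remove flip: S_def)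
  have deg: "degree (L i) < m" if "i < m" for i
  proof -
    have "card S = m" using bij bij_betw_same_card by fastforce
    thus ?thesis unfolding L_def degree_prod_linear
      using that \<zeta>S[OF that] fin by (simp add: card_Diff_singleton)
  qed
  \<comment> \<open>This carries the lower bound for the derivative over to the Lagrange
    denominators.\<close>
  have L_deriv: "poly (pderiv (cyclotomic_poly n)) (\<zeta> i) = poly (L i) (\<zeta> i)" if "i < m" for i
    unfolding \<Phi>[OF that] pderiv_mult by (simp add: pderiv_pCons)
  have L_lower: "norm (poly (L i) (\<zeta> i)) * B \<ge> 1" if "i < m" for i
    using norm_pderiv_cyclotomic_poly_ge[OF _ n] \<zeta>S[OF that]
    by (simp add: B_def S_def flip: L_deriv[OF that])
  have L0: "poly (L i) (\<zeta> i) \<noteq> 0" if "i < m" for i using L_lower[OF that] by auto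
  have L_other: "poly (L i) (\<zeta> l) = 0" if "i < m" "l < m" "i \<noteq> l" for i l
  proof -
    have "\<zeta> l \<in> S - {\<zeta> i}"
      using that \<zeta>S bij by (auto simp: bij_betw_def inj_on_def)
    thus ?thesis using fin by (auto simp: L_def poly_prod)
  qed
  have W_le: "norm (W $$ (j, i)) \<le> real m * H * B" if "j < m" "i < m" for i j
  proof -
    have "norm (coeff ([:- \<zeta> i, 1:] * L i) l) \<le> H" for l
      unfolding H_def \<Phi>[OF that(2), symmetric] by (rule norm_coeff_le_cyclotomic_height)
    hence "norm (coeff (L i) j) \<le> real m * H"
      using \<zeta>1[OF that(2)] deg[OF that(2)]
      by (intro norm_coeff_quotient_linear_le[of "\<zeta> i"]) auto
    \<comment> \<open>The inserted factor is at least 1; dividing by the denominator then leaves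
      just \<open>B\<close>.\<close>
    also have "real m * H * 1 \<le> real m * H * (norm (poly (L i) (\<zeta> i)) * B)"
      using L_lower[OF that(2)] H0 by (intro mult_left_mono) auto
    finally show ?thesis
      using that L0[OF that(2)] by (simp add: W_def norm_divide divide_le_eq mult_ac)
  qed
  have carrier: "V \<in> carrier_mat m m" "W \<in> carrier_mat m m"
    by (simp_all add: V_def W_def vandermonde_mat_def)
  have "V * W = 1\<^sub>m m"
  proof (rule eq_matI)
    fix l i assume "l < dim_row (1\<^sub>m m)" "i < dim_col (1\<^sub>m m)"
    hence li: "l < m" "i < m" by simp_all
    have "(V * W) $$ (l, i) = (\<Sum>j<m. \<zeta> l ^ j * (coeff (L i) j / poly (L i) (\<zeta> i)))"
      using li carrier by (simp add: V_def W_def vandermonde_mat_def scalar_prod_def lessThan_atLeast0)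
    also have "\<dots> = (\<Sum>j<m. coeff (L i) j * \<zeta> l ^ j) / poly (L i) (\<zeta> i)"
      by (simp add: sum_divide_distrib mult_ac)
    also have "(\<Sum>j<m. coeff (L i) j * \<zeta> l ^ j) = poly (L i) (\<zeta> l)"
      unfolding poly_altdef using deg[OF li(2)]
      by (intro sum.mono_neutral_right) (auto simp: coeff_eq_0)
    finally show "(V * W) $$ (l, i) = 1\<^sub>m m $$ (l, i)"
      using li L0 L_other by (cases "i = l") auto
  qed (use carrier in auto)
  hence "cond_number V = frobenius_norm V * frobenius_norm W"
    using mat_inverse_eqI[OF carrier] by (simp add: cond_number_def)
  also have "\<dots> \<le> (real m * 1) * (real m * (real m * H * B))"
    using carrier \<zeta>1 W_le H0 B0
    by (intro mult_mono frobenius_norm_le frobenius_norm_nonneg)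
       (auto simp: V_def vandermonde_mat_def norm_power)
  also have "\<dots> = real m ^ 3 * (H * B)" by (simp add: power3_eq_cube)
  also have "\<dots> \<le> real n ^ 3 * (H * B)"
    using mn H0 B0 by (intro mult_right_mono power_mono) auto
  finally show ?thesis by (simp add: V_def m_def H_def B_def mult.assoc)
qed

section \<open>From the explicit bound to powers of the conductor\<close>

lemma cond_number_powr_le:
  assumes n: "n \<ge> 2" and k: "card (prime_factors n) \<le> k"
    and enum: "enumerates_primitive_roots n \<zeta>"
    and K: "cyclotomic_height n \<le> K * real n powr r"
  shows "cond_number (vandermonde_mat (totient n) \<zeta>)
    \<le> K * real n powr (2 ^ k + real k + 3 + r)"
proof -
  have K0: "0 \<le> K * real n powr r" using cyclotomic_height_nonneg K by (rule order.trans)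
  have "cond_number (vandermonde_mat (totient n) \<zeta>)
      \<le> real n ^ 3 * cyclotomic_height n * real n ^ (2 ^ card (prime_factors n))"
    by (rule cond_number_le[OF n enum])
  also have "\<dots> \<le> real n ^ 3 * (K * real n powr r) * real n ^ (2 ^ k)"
    using n k K K0 cyclotomic_height_nonneg[of n] by (intro mult_mono power_increasing) auto
  also have "\<dots> = (K * real n powr r) * real n powr (2 ^ k + 3)"
    using n powr_realpow[of "real n" 3] powr_realpow[of "real n" "2 ^ k"]
    by (simp add: powr_add mult_ac)
  \<comment> \<open>The exponent so far is \<open>2 ^ k + 3 + r\<close>; since
    \<open>n \<ge> 1\<close>, it may be raised by \<open>k\<close> to reach the stated form.\<close>
  also have "\<dots> \<le> (K * real n powr r) * real n powr (2 ^ k + real k + 3)"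
    using n K0 by (intro mult_left_mono powr_mono) auto
  also have "\<dots> = K * real n powr (2 ^ k + real k + 3 + r)"
    by (simp add: powr_add mult_ac)
  finally show ?thesis .
qed

theorem corollary3p11:
  fixes k :: nat
  assumes "k \<ge> 1"
  shows
    "(\<exists>C>0. \<exists>c>0. \<forall>n\<ge>2. card (prime_factors n) \<le> k \<longrightarrow>
        (\<forall>\<zeta>. enumerates_primitive_roots n \<zeta> \<longrightarrow>
          cond_number (vandermonde_mat (totient n) \<zeta>) \<le> C * real n powr c))
     \<and>
     (\<forall>(F :: nat set) (r :: real).
        (\<forall>n\<in>F. n \<ge> 2 \<and> card (prime_factors n) \<le> k) \<longrightarrow>
        r \<ge> 0 \<longrightarrow>
        (\<exists>K>0. \<forall>n\<in>F. cyclotomic_height n \<le> K * real n powr r) \<longrightarrow>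
        (\<exists>C>0. \<forall>n\<in>F. \<forall>\<zeta>. enumerates_primitive_roots n \<zeta> \<longrightarrow>
          cond_number (vandermonde_mat (totient n) \<zeta>)
            \<le> C * real n powr (2 ^ k + real k + 3 + r)))"
proof (intro conjI allI impI)
  \<comment> \<open>This is the height hypothesis of the second claim with \<open>K = 1\<close> and
    \<open>r = 2 ^ k\<close>, so one estimate yields both claims.\<close>
  have height: "cyclotomic_height n \<le> 1 * real n powr (2 ^ k)"
    if "n \<ge> 2" "card (prime_factors n) \<le> k" for n
  proof -
    note cyclotomic_height_le[OF that(1)]
    also have "real n ^ (2 ^ card (prime_factors n)) \<le> real n ^ (2 ^ k)"
      using that by (intro power_increasing) auto
    also have "\<dots> = real n powr (2 ^ k)" using that by (simp flip: powr_realpow)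
    finally show ?thesis by simp
  qed
  show "\<exists>C>0. \<exists>c>0. \<forall>n\<ge>2. card (prime_factors n) \<le> k \<longrightarrow>
        (\<forall>\<zeta>. enumerates_primitive_roots n \<zeta> \<longrightarrow>
          cond_number (vandermonde_mat (totient n) \<zeta>) \<le> C * real n powr c)"
  proof (intro exI conjI allI impI)
    show "(1 :: real) > 0" "2 ^ k + real k + 3 + 2 ^ k > 0" by (auto intro!: add_nonneg_pos)
  qed (rule cond_number_powr_le[OF _ _ _ height])
next
  fix F :: "nat set" and r :: real
  assume F: "\<forall>n\<in>F. n \<ge> 2 \<and> card (prime_factors n) \<le> k"
    and "\<exists>K>0. \<forall>n\<in>F. cyclotomic_height n \<le> K * real n powr r"
  then obtain K where "K > 0" "\<forall>n\<in>F. cyclotomic_height n \<le> K * real n powr r" by blast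
  \<comment> \<open>The height constant \<open>K\<close> itself serves as \<open>C\<close>.\<close>
  with F show "\<exists>C>0. \<forall>n\<in>F. \<forall>\<zeta>. enumerates_primitive_roots n \<zeta> \<longrightarrow>
      cond_number (vandermonde_mat (totient n) \<zeta>) \<le> C * real n powr (2 ^ k + real k + 3 + r)"
    using cond_number_powr_le by blast
qed

end
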